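(* Let $E$ be a unital Banach algebra with unit $I$, let $a<b$, and let $A:[a,b]\to E$ be an idempotent-valued mapping, i.e. $A(t)\cdot A(t)=A(t)$ for all $t\in[a,b]$. If the Kurzweil-Stieltjes (respectively, Riemann-Stieltjes) product integral $\prod_a^b(I+\mathrm dA(t))$ exists, then the Kurzweil-Haahti (respectively, Riemann-Haahti) product $\prod_a^bA(t)$ exists as well, and $$\prod_a^bA(t)=\left(\prod_a^b(I+\mathrm dA(t))\right)\cdot A(a).$$
   Context: A unital Banach algebra is a complete normed algebra with unit $I$, $\|I\|=1$. Tagged partition of $[a,b]$: $(\xi_i,[t_{i-1},t_i])_{i=1}^m$ with $a=t_0<\dots<t_m=b$, $\xi_i\in[t_{i-1},t_i]$; for a gauge $\delta:[a,b]\to\mathbb R^+$ it is $\delta$-fine if $[t_{i-1},t_i]\subset(\xi_i-\delta(\xi_i),\xi_i+\delta(\xi_i))$ for all $i$. Kurzweil-Stieltjes product integral: $\prod_a^b(I+\mathrm dA(t))=P$ if $P\in E$ is invertible and for every $\varepsilon>0$ there is a gauge $\delta$ with $\|(I+A(t_m)-A(t_{m-1}))\cdots(I+A(t_1)-A(t_0))-P\|<\varepsilon$ for every $\delta$-fine tagged partition of $[a,b]$. Riemann-Stieltjes product integral: the same with $\delta$ required to be constant. Kurzweil-Haahti product: $\prod_a^bA(t)=P_A$ if $P_A\in E$ (not necessarily invertible) and for every $\varepsilon>0$ there is a gauge $\delta$ with $\|P_A-A(t_m)A(t_{m-1})\cdots A(t_0)\|<\varepsilon$ for every $\delta$-fine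 tagged partition of $[a,b]$. Riemann-Haahti product: the same with $\delta$ required to be constant. *)

theory Defs
  imports Complex_Main
begin

text \<open>
  If \<open>a < b\<close> then \<open>m \<ge> 1\<close> is forced; the empty partition \<open>m = 0\<close> only occurs for \<open>a = b\<close>.
\<close>

definition tagged_partition ::
    "real \<Rightarrow> real \<Rightarrow> nat \<Rightarrow> (nat \<Rightarrow> real) \<Rightarrow> (nat \<Rightarrow> real) \<Rightarrow> bool" where
  "tagged_partition a b m t \<xi> \<longleftrightarrow>
     t 0 = a \<and> t m = b \<and> (\<forall>i\<in>{1..m}. t (i - 1) < t i \<and> \<xi> i \<in> {t (i - 1)..t i})"

definition fine_partition ::
    "(real \<Rightarrow> real) \<Rightarrow> nat \<Rightarrow> (nat \<Rightarrow> real) \<Rightarrow> (nat \<Rightarrow> real) \<Rightarrow> bool" where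
  "fine_partition \<delta> m t \<xi> \<longleftrightarrow>
     (\<forall>i\<in>{1..m}. {t (i - 1)..t i} \<subseteq> {\<xi> i - \<delta> (\<xi> i)<..<\<xi> i + \<delta> (\<xi> i)})"

definition gauge_on :: "real \<Rightarrow> real \<Rightarrow> (real \<Rightarrow> real) \<Rightarrow> bool" where
  "gauge_on a b \<delta> \<longleftrightarrow> (\<forall>x\<in>{a..b}. 0 < \<delta> x)"

definition invertible_elem :: "'a::monoid_mult \<Rightarrow> bool" where
  "invertible_elem x \<longleftrightarrow> (\<exists>y. x * y = 1 \<and> y * x = 1)"

text \<open>The factors of both products are ordered with the index decreasing from left to right.\<close>

definition stieltjes_product ::
    "(real \<Rightarrow> 'a::{real_normed_algebra_1,banach}) \<Rightarrow> nat \<Rightarrow> (nat \<Rightarrow> real) \<Rightarrow> 'a" where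
  "stieltjes_product A m t =
     prod_list (map (\<lambda>i. 1 + A (t i) - A (t (i - 1))) (rev [1..<Suc m]))"

definition haahti_product ::
    "(real \<Rightarrow> 'a::{real_normed_algebra_1,banach}) \<Rightarrow> nat \<Rightarrow> (nat \<Rightarrow> real) \<Rightarrow> 'a" where
  "haahti_product A m t = prod_list (map (\<lambda>i. A (t i)) (rev [0..<Suc m]))"

definition has_kurzweil_limit ::
    "(nat \<Rightarrow> (nat \<Rightarrow> real) \<Rightarrow> 'a::{real_normed_algebra_1,banach}) \<Rightarrow> real \<Rightarrow> real \<Rightarrow> 'a \<Rightarrow> bool" where
  "has_kurzweil_limit S a b P \<longleftrightarrow>
     (\<forall>\<epsilon>>0. \<exists>\<delta>. gauge_on a b \<delta> \<and>
        (\<forall>m t \<xi>. tagged_partition a b m t \<xi> \<and> fine_partition \<delta> m t \<xi> \<longrightarrow> norm (S m t - P) < \<epsilon>))"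

definition has_riemann_limit ::
    "(nat \<Rightarrow> (nat \<Rightarrow> real) \<Rightarrow> 'a::{real_normed_algebra_1,banach}) \<Rightarrow> real \<Rightarrow> real \<Rightarrow> 'a \<Rightarrow> bool" where
  "has_riemann_limit S a b P \<longleftrightarrow>
     (\<forall>\<epsilon>>0. \<exists>d>0.
        (\<forall>m t \<xi>. tagged_partition a b m t \<xi> \<and> fine_partition (\<lambda>_. d) m t \<xi> \<longrightarrow> norm (S m t - P) < \<epsilon>))"

definition has_kurzweil_stieltjes ::
    "(real \<Rightarrow> 'a::{real_normed_algebra_1,banach}) \<Rightarrow> real \<Rightarrow> real \<Rightarrow> 'a \<Rightarrow> bool" where
  "has_kurzweil_stieltjes A a b P \<longleftrightarrow>
     invertible_elem P \<and> has_kurzweil_limit (stieltjes_product A) a b P"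

definition has_riemann_stieltjes ::
    "(real \<Rightarrow> 'a::{real_normed_algebra_1,banach}) \<Rightarrow> real \<Rightarrow> real \<Rightarrow> 'a \<Rightarrow> bool" where
  "has_riemann_stieltjes A a b P \<longleftrightarrow>
     invertible_elem P \<and> has_riemann_limit (stieltjes_product A) a b P"

definition has_kurzweil_haahti ::
    "(real \<Rightarrow> 'a::{real_normed_algebra_1,banach}) \<Rightarrow> real \<Rightarrow> real \<Rightarrow> 'a \<Rightarrow> bool" where
  "has_kurzweil_haahti A a b P \<longleftrightarrow> has_kurzweil_limit (haahti_product A) a b P"

definition has_riemann_haahti ::
    "(real \<Rightarrow> 'a::{real_normed_algebra_1,banach}) \<Rightarrow> real \<Rightarrow> real \<Rightarrow> 'a \<Rightarrow> bool" where
  "has_riemann_haahti A a b P \<longleftrightarrow> has_riemann_limit (haahti_product A) a b P"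

text \<open>
  The values are well defined for \<open>a \<le> b\<close>, since limits along fine partitions are unique
  (Cousin's lemma); see \<open>has_kurzweil_limit_unique\<close> and \<open>has_riemann_limit_unique\<close> below.
\<close>

definition kurzweil_stieltjes ::
    "(real \<Rightarrow> 'a::{real_normed_algebra_1,banach}) \<Rightarrow> real \<Rightarrow> real \<Rightarrow> 'a" where
  "kurzweil_stieltjes A a b = (THE P. has_kurzweil_stieltjes A a b P)"

definition riemann_stieltjes ::
    "(real \<Rightarrow> 'a::{real_normed_algebra_1,banach}) \<Rightarrow> real \<Rightarrow> real \<Rightarrow> 'a" where
  "riemann_stieltjes A a b = (THE P. has_riemann_stieltjes A a b P)"

definition kurzweil_haahti ::
    "(real \<Rightarrow> 'a::{real_normed_algebra_1,banach}) \<Rightarrow> real \<Rightarrow> real \<Rightarrow> 'a" where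
  "kurzweil_haahti A a b = (THE P. has_kurzweil_haahti A a b P)"

definition riemann_haahti ::
    "(real \<Rightarrow> 'a::{real_normed_algebra_1,banach}) \<Rightarrow> real \<Rightarrow> real \<Rightarrow> 'a" where
  "riemann_haahti A a b = (THE P. has_riemann_haahti A a b P)"

lemma fine_tagged_partition_exists:
  assumes "a \<le> b" and "gauge_on a b \<delta>"
  shows "\<exists>m t \<xi>. tagged_partition a b m t \<xi> \<and> fine_partition \<delta> m t \<xi>"
  using assms(1)
proof (induction rule: Bolzano)
  case (trans u v w)
  then obtain m t \<xi> n s \<eta> where
    1: "tagged_partition u v m t \<xi>" "fine_partition \<delta> m t \<xi>" and
    2: "tagged_partition v w n s \<eta>" "fine_partition \<delta> n s \<eta>"
    by blast
  define t' where "t' i = (if i \<le> m then t i else s (i - m))" for i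
  define \<xi>' where "\<xi>' i = (if i \<le> m then \<xi> i else \<eta> (i - m))" for i
  have seam: "t m = s 0"
    using 1 2 by (simp add: tagged_partition_def)
  have t'_shift: "t' i = s (i - m)" if "m \<le> i" for i
    using that seam by (auto simp: t'_def)
  have step: "t' (i - 1) < t' i \<and> \<xi>' i \<in> {t' (i - 1)..t' i} \<and>
      {t' (i - 1)..t' i} \<subseteq> {\<xi>' i - \<delta> (\<xi>' i)<..<\<xi>' i + \<delta> (\<xi>' i)}" if i: "i \<in> {1..m + n}" for i
  proof (cases "i \<le> m")
    case True
    then have "t' (i - 1) = t (i - 1)" "t' i = t i" "\<xi>' i = \<xi> i" "i \<in> {1..m}"
      using i by (auto simp: t'_def \<xi>'_def)
    then show ?thesis
      using 1 unfolding tagged_partition_def fine_partition_def by metis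
  next
    case False
    then have "t' (i - 1) = s (i - m - 1)" "t' i = s (i - m)" "\<xi>' i = \<eta> (i - m)" "i - m \<in> {1..n}"
      using i t'_shift[of "i - 1"] t'_shift[of i] by (auto simp: \<xi>'_def)
    then show ?thesis
      using 2 unfolding tagged_partition_def fine_partition_def by metis
  qed
  have "t' 0 = u" "t' (m + n) = w"
    using 1 2 t'_shift[of "m + n"] by (auto simp: tagged_partition_def t'_def)
  then show ?case
    using step unfolding tagged_partition_def fine_partition_def by blast
next
  case (local x)
  then have pos: "0 < \<delta> x"
    using assms(2) by (simp add: gauge_on_def)
  have "\<exists>m t \<xi>. tagged_partition u v m t \<xi> \<and> fine_partition \<delta> m t \<xi>"
    if "u \<le> x" "x \<le> v" "v - u < \<delta> x" for u v
  proof (cases "u = v")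
    case True
    then show ?thesis
      by (intro exI[of _ 0] exI[of _ "\<lambda>_. u"]) (simp add: tagged_partition_def fine_partition_def)
  next
    case False
    then show ?thesis
      using that
      by (intro exI[of _ 1] exI[of _ "\<lambda>i. if i = 0 then u else v"] exI[of _ "\<lambda>_. x"])
        (auto simp: tagged_partition_def fine_partition_def)
  qed
  with pos show ?case by blast
qed

lemma has_kurzweil_limit_unique:
  assumes "a \<le> b" and "has_kurzweil_limit S a b P" and "has_kurzweil_limit S a b Q"
  shows "P = Q"
proof (rule ccontr)
  assume "P \<noteq> Q"
  then have e: "0 < norm (P - Q) / 2" by simp
  obtain \<delta> where \<delta>: "gauge_on a b \<delta>"
    "\<And>m t \<xi>. tagged_partition a b m t \<xi> \<Longrightarrow> fine_partition \<delta> m t \<xi> \<Longrightarrow> norm (S m t - P) < norm (P - Q) / 2"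
    using assms(2) e unfolding has_kurzweil_limit_def by meson
  obtain \<delta>' where \<delta>': "gauge_on a b \<delta>'"
    "\<And>m t \<xi>. tagged_partition a b m t \<xi> \<Longrightarrow> fine_partition \<delta>' m t \<xi> \<Longrightarrow> norm (S m t - Q) < norm (P - Q) / 2"
    using assms(3) e unfolding has_kurzweil_limit_def by meson
  have "gauge_on a b (\<lambda>x. min (\<delta> x) (\<delta>' x))"
    using \<delta>(1) \<delta>'(1) by (simp add: gauge_on_def)
  then obtain m t \<xi> where p: "tagged_partition a b m t \<xi>"
    "fine_partition (\<lambda>x. min (\<delta> x) (\<delta>' x)) m t \<xi>"
    using fine_tagged_partition_exists assms(1) by blast
  then have "fine_partition \<delta> m t \<xi>" "fine_partition \<delta>' m t \<xi>"
    unfolding fine_partition_def by fastforce+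
  then have "norm (S m t - P) < norm (P - Q) / 2" "norm (S m t - Q) < norm (P - Q) / 2"
    using \<delta>(2) \<delta>'(2) p(1) by blast+
  moreover have "norm (P - Q) \<le> norm (S m t - Q) + norm (S m t - P)"
    using norm_triangle_ineq4[of "S m t - Q" "S m t - P"] by simp
  ultimately show False by linarith
qed

lemma has_riemann_limit_imp_has_kurzweil_limit:
  "has_riemann_limit S a b P \<Longrightarrow> has_kurzweil_limit S a b P"
  unfolding has_riemann_limit_def has_kurzweil_limit_def gauge_on_def by meson

lemma has_riemann_limit_unique:
  assumes "a \<le> b" and "has_riemann_limit S a b P" and "has_riemann_limit S a b Q"
  shows "P = Q"
  using assms has_kurzweil_limit_unique has_riemann_limit_imp_has_kurzweil_limit by blast

end

theory Submission imports Defs begin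

text \<open>
  If \<open>A s\<close> is idempotent then \<open>(1 + A t - A s) * A s = A t * A s\<close>. Hence multiplying the Stieltjes
  product of a partition by \<open>A a\<close> on the right collapses it, factor by factor, exactly into the
  Haahti product, and the limits along fine partitions agree up to the factor \<open>A a\<close>.
\<close>

text \<open>Idempotence of \<open>A\<close> is available only on \<open>{a..b}\<close>, so the
  division points have to be located there. They increase from \<open>t 0 = a\<close> to
  \<open>t m = b\<close>; beyond index \<open>m\<close> the function \<open>t\<close> is arbitrary,
  hence the bounds on the indices.\<close>

lemma tagged_partition_in_interval:
  assumes part: "tagged_partition a b m t \<xi>" and i: "i \<le> m"
  shows "t i \<in> {a..b}"
proof -
  have le: "t k \<le> t (Suc k)" if "k < m" for k
    using part that unfolding tagged_partition_def by (force dest: bspec[of _ _ "Suc k"])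
  have mono: "j \<le> m \<Longrightarrow> t i \<le> t j" if "i \<le> j" for i j
    using that
  proof (induction j rule: dec_induct)
    case (step n)
    then show ?case using le[of n] by linarith
  qed simp
  show ?thesis
    using mono[of 0 i] mono[of i m] part i by (auto simp: tagged_partition_def)
qed

lemma haahti_product_eq_stieltjes_product_mult:
  assumes "\<And>i. i < m \<Longrightarrow> A (t i) * A (t i) = A (t i)"
  shows "haahti_product A m t = stieltjes_product A m t * A (t 0)"
  using assms
proof (induction m)
  case 0
  then show ?case by (simp add: haahti_product_def stieltjes_product_def)
next
  case (Suc m)
  have haahti_Suc: "haahti_product A (Suc n) t = A (t (Suc n)) * haahti_product A n t" for n
    by (simp add: haahti_product_def)
  \<comment> \<open>The leftmost factor of this product is \<open>A (t m)\<close>, so by idempotence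
    one more copy of it on the left changes nothing.\<close>
  have absorb: "A (t m) * haahti_product A m t = haahti_product A m t"
    using Suc.prems[of m] by (simp add: haahti_product_def mult.assoc[symmetric])
  \<comment> \<open>The factor of largest index stands leftmost and splits off; what remains, times
    \<open>A (t 0)\<close>, is the subject of the induction hypothesis.\<close>
  have "stieltjes_product A (Suc m) t * A (t 0)
      = (1 + A (t (Suc m)) - A (t m)) * (stieltjes_product A m t * A (t 0))"
    by (simp add: stieltjes_product_def mult.assoc)
  also have "\<dots> = (1 + A (t (Suc m)) - A (t m)) * haahti_product A m t"
    using Suc by simp
  \<comment> \<open>After distributing, the terms from \<open>1\<close> and \<open>- A (t m)\<close>
    cancel by \<open>absorb\<close>.\<close>
  also have "\<dots> = haahti_product A (Suc m) t"
    by (simp add: haahti_Suc algebra_simps absorb)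
  finally show ?case ..
qed

text \<open>Right multiplication by \<open>c\<close> is Lipschitz with constant
  \<open>norm c\<close>. The added 1 keeps the denominator positive when \<open>c = 0\<close> and
  makes the final inequality strict.\<close>

lemma norm_mult_diff_less:
  fixes x y c :: "'a::real_normed_algebra"
  assumes "norm (x - y) < \<epsilon> / (norm c + 1)" and "0 < \<epsilon>"
  shows "norm (x * c - y * c) < \<epsilon>"
proof -
  have "norm (x * c - y * c) \<le> norm (x - y) * norm c"
    by (metis left_diff_distrib norm_mult_ineq)
  also have "\<dots> \<le> \<epsilon> / (norm c + 1) * norm c"
    using assms(1) by (intro mult_right_mono) auto
  also have "\<dots> < \<epsilon>"
    using assms(2) by (simp add: field_simps add_pos_nonneg)
  finally show ?thesis .
qed

text \<open>A gauge that serves \<open>S\<close> for \<open>\<epsilon> / (norm c + 1)\<close> serves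
  \<open>S'\<close> for \<open>\<epsilon>\<close>. The relation between \<open>S\<close> and
  \<open>S'\<close> is asked only on tagged partitions of \<open>[a,b]\<close>, since the collapse
  of the products uses \<open>t 0 = a\<close> and idempotence at the division points.\<close>

lemma has_kurzweil_limit_mult_right:
  assumes lim: "has_kurzweil_limit S a b P"
    and eq: "\<And>m t \<xi>. tagged_partition a b m t \<xi> \<Longrightarrow> S' m t = S m t * c"
  shows "has_kurzweil_limit S' a b (P * c)"
  unfolding has_kurzweil_limit_def
proof (intro allI impI)
  fix \<epsilon> :: real assume \<epsilon>: "0 < \<epsilon>"
  then have "0 < \<epsilon> / (norm c + 1)" by (simp add: add_nonneg_pos)
  then obtain \<delta> where "gauge_on a b \<delta>"
    "\<And>m t \<xi>. tagged_partition a b m t \<xi> \<Longrightarrow> fine_partition \<delta> m t \<xi> \<Longrightarrow>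
      norm (S m t - P) < \<epsilon> / (norm c + 1)"
    using lim unfolding has_kurzweil_limit_def by meson
  then show "\<exists>\<delta>. gauge_on a b \<delta> \<and> (\<forall>m t \<xi>. tagged_partition a b m t \<xi> \<and>
      fine_partition \<delta> m t \<xi> \<longrightarrow> norm (S' m t - P * c) < \<epsilon>)"
    using norm_mult_diff_less[OF _ \<epsilon>] by (metis eq)
qed

text \<open>The gauge is passed on unchanged, so a constant one stays constant.\<close>

lemma has_riemann_limit_mult_right:
  assumes lim: "has_riemann_limit S a b P"
    and eq: "\<And>m t \<xi>. tagged_partition a b m t \<xi> \<Longrightarrow> S' m t = S m t * c"
  shows "has_riemann_limit S' a b (P * c)"
  unfolding has_riemann_limit_def
proof (intro allI impI)
  fix \<epsilon> :: real assume \<epsilon>: "0 < \<epsilon>"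
  then have "0 < \<epsilon> / (norm c + 1)" by (simp add: add_nonneg_pos)
  then obtain d where "d > 0"
    "\<And>m t \<xi>. tagged_partition a b m t \<xi> \<Longrightarrow> fine_partition (\<lambda>_. d) m t \<xi> \<Longrightarrow>
      norm (S m t - P) < \<epsilon> / (norm c + 1)"
    using lim unfolding has_riemann_limit_def by meson
  then show "\<exists>d>0. \<forall>m t \<xi>. tagged_partition a b m t \<xi> \<and>
      fine_partition (\<lambda>_. d) m t \<xi> \<longrightarrow> norm (S' m t - P * c) < \<epsilon>"
    using norm_mult_diff_less[OF _ \<epsilon>] by (metis eq)
qed

theorem theorem7p2:
  fixes A :: "real \<Rightarrow> 'a::{real_normed_algebra_1,banach}" and a b :: real
  assumes "a < b"
    and "\<And>t. t \<in> {a..b} \<Longrightarrow> A t * A t = A t"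
  shows "((\<exists>P. has_kurzweil_stieltjes A a b P) \<longrightarrow>
            (\<exists>P. has_kurzweil_haahti A a b P) \<and>
            kurzweil_haahti A a b = kurzweil_stieltjes A a b * A a) \<and>
         ((\<exists>P. has_riemann_stieltjes A a b P) \<longrightarrow>
            (\<exists>P. has_riemann_haahti A a b P) \<and>
            riemann_haahti A a b = riemann_stieltjes A a b * A a)"
proof -
  have ab: "a \<le> b" using assms(1) by simp
  have eq: "haahti_product A m t = stieltjes_product A m t * A a"
    if part: "tagged_partition a b m t \<xi>" for m t \<xi>
  proof -
    have "t 0 = a" using part by (simp add: tagged_partition_def)
    moreover have "A (t i) * A (t i) = A (t i)" if "i < m" for i
      using assms(2) tagged_partition_in_interval[OF part] that by simp
    ultimately show ?thesis
      using haahti_product_eq_stieltjes_product_mult[of m A t] by simp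
  qed
  have "has_kurzweil_haahti A a b (P * A a) \<and>
      kurzweil_haahti A a b = kurzweil_stieltjes A a b * A a"
    if P: "has_kurzweil_stieltjes A a b P" for P
  proof -
    \<comment> \<open>\<open>P * A a\<close> is invertible only if the idempotent \<open>A a\<close>
      is 1, but a Haahti product need not be invertible.\<close>
    have "has_kurzweil_haahti A a b (P * A a)"
      using P eq unfolding has_kurzweil_stieltjes_def has_kurzweil_haahti_def
      by (blast intro: has_kurzweil_limit_mult_right)
    \<comment> \<open>Uniqueness of limits identifies the values chosen by
      \<open>THE\<close>.\<close>
    moreover from this have "kurzweil_haahti A a b = P * A a"
      using has_kurzweil_limit_unique[OF ab]
      unfolding kurzweil_haahti_def has_kurzweil_haahti_def by blast
    moreover have "kurzweil_stieltjes A a b = P"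
      using P has_kurzweil_limit_unique[OF ab]
      unfolding kurzweil_stieltjes_def has_kurzweil_stieltjes_def by blast
    ultimately show ?thesis by simp
  qed
  moreover have "has_riemann_haahti A a b (P * A a) \<and>
      riemann_haahti A a b = riemann_stieltjes A a b * A a"
    if P: "has_riemann_stieltjes A a b P" for P
  proof -
    have "has_riemann_haahti A a b (P * A a)"
      using P eq unfolding has_riemann_stieltjes_def has_riemann_haahti_def
      by (blast intro: has_riemann_limit_mult_right)
    moreover from this have "riemann_haahti A a b = P * A a"
      using has_riemann_limit_unique[OF ab]
      unfolding riemann_haahti_def has_riemann_haahti_def by blast
    moreover have "riemann_stieltjes A a b = P"
      using P has_riemann_limit_unique[OF ab]
      unfolding riemann_stieltjes_def has_riemann_stieltjes_def by blast
    ultimately show ?thesis by simp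
  qed
  ultimately show ?thesis by blast
qed

end
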